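(* Let $X,Y$ be Banach spaces and let $P:X\times Y\rightrightarrows X$ be a convex valued map that is mid-point continuous with respect to $X$ and satisfies $x\notin P(x,y)$ for every $(x,y)\in X\times Y$. Then there exists a norm-weak$^*$ upper semi-continuous map $F:X\times Y\rightrightarrows X^*$ with non-empty convex weak$^*$ compact values such that $F(x,y)\subseteq N_P(x,y)\setminus\{0\}$ whenever $P(x,y)\neq\emptyset$.
   Context: Banach spaces are real; $X^*$ is the topological dual. $P:A\rightrightarrows B$ denotes a set-valued map (values may be empty). $P:X\times Y\rightrightarrows X$ is mid-point continuous with respect to $X$ if for every $(x,y)\in X\times Y$ and every $w\in P(x,y)$ there exist $t\in[0,1)$ and open sets $V,W\subseteq X$, $O\subseteq Y$ such that $tx+(1-t)w\in V$, $x\in W$, $y\in O$, and $w'\in P(x',y')$ for all $w'\in V$, $x'\in W$, $y'\in O$. The normal cone operator $N_P:X\times Y\rightrightarrows X^*$ is $N_P(x,y)=\{x^*\in X^*:\langle x^*,z-x\rangle\le 0\ \forall z\in P(x,y)\}$ if $P(x,y)\neq\emptyset$, and $N_P(x,y)=X^*$ otherwise. Norm-weak$^*$ upper semi-continuity means upper semi-continuity with the norm topology on $X\times Y$ and the weak$^*$ topology on $X^*$. *)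

theory Defs
  imports "HOL-Analysis.Analysis"
begin

(* A set-valued map from A to B is a function of type A => B set, with the empty set allowed
   as a value. The topological dual of X is the type of bounded linear functionals on X. *)

type_synonym 'a dual = "'a \<Rightarrow>\<^sub>L real"

(* For scalar-valued operators, the strong operator topology (pointwise convergence on X)
   is the weak* topology of the dual; see limitin_weak_star below. *)
abbreviation weak_star :: "('a::real_normed_vector) dual topology"
  where "weak_star \<equiv> strong_operator_topology"

lemma limitin_weak_star:
  fixes l :: "('a::real_normed_vector) dual"
  shows "limitin weak_star f l F \<longleftrightarrow> (\<forall>x. ((\<lambda>i. blinfun_apply (f i) x) \<longlongrightarrow> blinfun_apply l x) F)"
proof -
  have "limitin weak_star f l F \<longleftrightarrow> ((\<lambda>i. blinfun_apply (f i)) \<longlongrightarrow> blinfun_apply l) F"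
    by (auto simp: limitin_def strong_operator_topology_def topspace_pullback_topology
        openin_pullback_topology tendsto_def)
  also have "\<dots> \<longleftrightarrow> (\<forall>x. ((\<lambda>i. blinfun_apply (f i) x) \<longlongrightarrow> blinfun_apply l x) F)"
    unfolding limitin_canonical_iff[symmetric] euclidean_product_topology[symmetric]
    by (simp add: limitin_componentwise del: limitin_canonical_iff)
  finally show ?thesis .
qed

definition upper_semicontinuous_setmap ::
    "'a topology \<Rightarrow> 'b topology \<Rightarrow> ('a \<Rightarrow> 'b set) \<Rightarrow> bool"
  where "upper_semicontinuous_setmap S T F \<longleftrightarrow>
    (\<forall>x\<in>topspace S. \<forall>V. openin T V \<and> F x \<subseteq> V \<longrightarrow>
      (\<exists>U. openin S U \<and> x \<in> U \<and> (\<forall>u\<in>U. F u \<subseteq> V)))"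

definition midpoint_continuous ::
    "('a::real_normed_vector \<times> 'b::real_normed_vector \<Rightarrow> 'a set) \<Rightarrow> bool"
  where "midpoint_continuous P \<longleftrightarrow>
    (\<forall>x y. \<forall>w\<in>P (x, y). \<exists>t V W Q.
      0 \<le> t \<and> t < (1::real) \<and> open V \<and> open W \<and> open Q \<and>
      t *\<^sub>R x + (1 - t) *\<^sub>R w \<in> V \<and> x \<in> W \<and> y \<in> Q \<and>
      (\<forall>w'\<in>V. \<forall>x'\<in>W. \<forall>y'\<in>Q. w' \<in> P (x', y')))"

definition normal_cone ::
    "('a::real_normed_vector \<times> 'b \<Rightarrow> 'a set) \<Rightarrow> 'a \<times> 'b \<Rightarrow> 'a dual set"
  where "normal_cone P = (\<lambda>(x, y).
    if P (x, y) \<noteq> {} then {f. \<forall>z\<in>P (x, y). blinfun_apply f (z - x) \<le> 0} else UNIV)"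

end

theory Submission
  imports Defs
begin

text \<open>The natural candidate for \<open>F (x, y)\<close>, the set \<open>A (x, y)\<close> of unit functionals in the normal
cone, is in general neither convex nor weak* closed, and a weak* limit of unit functionals can
be \<open>0\<close>.
Mid-point continuity rules out this degeneration locally. If \<open>z \<in> P (x, y)\<close>, then some point
\<open>v = t x + (1 - t) z\<close> is the centre of a fixed ball contained in \<open>P q\<close> for all \<open>q\<close> near \<open>(x, y)\<close>, so
that \<open>g (v - x) \<le> - r * norm g\<close> for one \<open>r > 0\<close> and all functionals \<open>g\<close> normal at such \<open>q\<close>
(\<open>normal_cone_uniformly_negative\<close>). For unit \<open>g\<close> this is a weak* closed half-space that misses \<open>0\<close>,
and it survives convex combinations and weak* limits.

It is therefore enough to close and convexify \<open>A\<close> locally: let \<open>F p\<close> be the intersection, over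
all \<open>e > 0\<close>, of the weak* closed convex hulls of the union of the \<open>A q\<close> with \<open>q \<in> ball p e\<close>. These
hulls are weak* compact by Banach-Alaoglu and decrease with \<open>e\<close>, which makes \<open>F\<close> upper
semi-continuous, whatever the bounded family \<open>A\<close>. Each point of the domain of \<open>P\<close> is treated
with its own vector \<open>v - x\<close>, so that no continuous selection of such vectors has to be made. That \<open>F p\<close> stays
inside the normal cone is again mid-point continuity: the inequality \<open>g (v - x') \<le> 0\<close> holds for the
functionals normal at nearby points \<open>(x', y')\<close>, passes to \<open>F (x, y)\<close> as \<open>f (v - x) \<le> 0\<close>, and
\<open>v - x = (1 - t) (z - x)\<close> with \<open>1 - t > 0\<close>.

Non-emptiness of \<open>A (x, y)\<close> is a separation theorem: \<open>P (x, y)\<close> is convex, has interior points and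
misses \<open>x\<close>. It is derived here from the Hahn-Banach theorem in the form that every sublinear
functional dominates a linear one.\<close>

section \<open>Hahn-Banach for sublinear functionals\<close>

definition sublinear :: "('a::real_vector \<Rightarrow> real) \<Rightarrow> bool"
  where "sublinear p \<longleftrightarrow>
    (\<forall>x y. p (x + y) \<le> p x + p y) \<and> (\<forall>c\<ge>0. \<forall>x. p (c *\<^sub>R x) = c * p x)"

text \<open>For \<open>c > 0\<close> the two inequalities for \<open>c\<close> and \<open>1 / c\<close> give equality, and \<open>p 0 = 2 * p 0\<close> settles
\<open>c = 0\<close>.\<close>

lemma sublinearI:
  assumes add: "\<And>x y. p (x + y) \<le> p x + p y"
    and scale: "\<And>c x. 0 < c \<Longrightarrow> p (c *\<^sub>R x) \<le> c * p x"
  shows "sublinear p"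
proof -
  have eq: "p (c *\<^sub>R x) = c * p x" if "0 < c" for c x
  proof -
    have "p ((1 / c) *\<^sub>R (c *\<^sub>R x)) \<le> (1 / c) * p (c *\<^sub>R x)"
      using that by (intro scale) simp
    then have "c * p x \<le> p (c *\<^sub>R x)"
      using that by (simp add: field_simps)
    with scale[OF that, of x] show ?thesis by simp
  qed
  have "p 0 = 0"
    using eq[of 2 0] by simp
  then have "p (c *\<^sub>R x) = c * p x" if "0 \<le> c" for c x
    using that eq[of c x] by (cases "c = 0") auto
  with add show ?thesis
    by (auto simp: sublinear_def)
qed

lemma sublinear_add: "sublinear p \<Longrightarrow> p (x + y) \<le> p x + p y"
  by (simp add: sublinear_def)

lemma sublinear_scale: "sublinear p \<Longrightarrow> 0 \<le> c \<Longrightarrow> p (c *\<^sub>R x) = c * p x"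
  by (simp add: sublinear_def)

lemma sublinear_zero: "sublinear p \<Longrightarrow> p 0 = 0"
  using sublinear_scale[of p 0 0] by simp

lemma sublinear_ge_minus: "sublinear p \<Longrightarrow> - p (- x) \<le> p x"
  using sublinear_add[of p x "- x"] sublinear_zero[of p] by simp

text \<open>The chain condition of Zorn's lemma. The infimum is finite because every \<open>q \<le> p\<close> satisfies
\<open>q x \<ge> - q (- x) \<ge> - p (- x)\<close>; it is subadditive because two members of the chain can be compared
with the smaller of them.\<close>

lemma sublinear_INF_chain:
  assumes "C \<noteq> {}" and sub: "\<And>q. q \<in> C \<Longrightarrow> sublinear q" and "\<And>q. q \<in> C \<Longrightarrow> q \<le> p"
    and chain: "\<And>q r. q \<in> C \<Longrightarrow> r \<in> C \<Longrightarrow> q \<le> r \<or> r \<le> q"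
  shows "sublinear (\<lambda>x. INF q\<in>C. q x)" and "\<And>q. q \<in> C \<Longrightarrow> (\<lambda>x. INF q\<in>C. q x) \<le> q"
proof -
  have bdd: "bdd_below ((\<lambda>q. q x) ` C)" for x
  proof (rule bdd_belowI2)
    fix q assume "q \<in> C"
    then show "- p (- x) \<le> q x"
      using sublinear_ge_minus[OF sub, of q x] le_funD[OF assms(3), of q "- x"] by simp
  qed
  have lower: "(INF q\<in>C. q x) \<le> q x" if "q \<in> C" for q x
    using bdd that by (rule cINF_lower)
  then show "\<And>q. q \<in> C \<Longrightarrow> (\<lambda>x. INF q\<in>C. q x) \<le> q"
    by (simp add: le_fun_def)
  show "sublinear (\<lambda>x. INF q\<in>C. q x)"
  proof (rule sublinearI)
    fix x y
    have *: "(INF q\<in>C. q (x + y)) \<le> q x + r y" if "q \<in> C" "r \<in> C" for q r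
    proof -
      obtain s where "s \<in> C" "s \<le> q" "s \<le> r"
        using chain[of q r] \<open>q \<in> C\<close> \<open>r \<in> C\<close> order_refl by metis
      then show ?thesis
        using lower[of s "x + y"] sublinear_add[OF sub, of s x y]
          le_funD[of s q x] le_funD[of s r y] by linarith
    qed
    have "(INF q\<in>C. q (x + y)) - r y \<le> (INF q\<in>C. q x)" if "r \<in> C" for r
      using \<open>C \<noteq> {}\<close> * that by (intro cINF_greatest) (auto simp: diff_le_eq)
    then have "(INF q\<in>C. q (x + y)) - (INF q\<in>C. q x) \<le> (INF q\<in>C. q y)"
      using \<open>C \<noteq> {}\<close> by (intro cINF_greatest) (auto simp: diff_le_eq add.commute)
    then show "(INF q\<in>C. q (x + y)) \<le> (INF q\<in>C. q x) + (INF q\<in>C. q y)"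
      by simp
  next
    fix c :: real and x assume "0 < c"
    have "(INF q\<in>C. q (c *\<^sub>R x)) / c \<le> (INF q\<in>C. q x)"
    proof (rule cINF_greatest[OF \<open>C \<noteq> {}\<close>])
      fix q assume "q \<in> C"
      then show "(INF q\<in>C. q (c *\<^sub>R x)) / c \<le> q x"
        using lower[of q "c *\<^sub>R x"] sublinear_scale[OF sub, of q c x] \<open>0 < c\<close>
        by (simp add: field_simps)
    qed
    then show "(INF q\<in>C. q (c *\<^sub>R x)) \<le> c * (INF q\<in>C. q x)"
      using \<open>0 < c\<close> by (simp add: field_simps)
  qed
qed

text \<open>A sublinear \<open>q\<close> is linear exactly if \<open>q (- y) = - q y\<close>, and \<open>q (- y) \<ge> - q y\<close> always holds. The
functional \<open>r x = inf {q (x + s y) - s q y | s \<ge> 0}\<close> is again sublinear and below \<open>q\<close>, and it satisfies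
\<open>r (- y) \<le> - q y\<close> by the choice \<open>s = 1\<close>; minimality turns this into the missing inequality.\<close>

lemma minimal_sublinear_linear:
  assumes q: "sublinear q" and min: "\<And>r. sublinear r \<Longrightarrow> r \<le> q \<Longrightarrow> r = q"
  shows "linear q"
proof -
  have le: "q (- y) \<le> - q y" for y
  proof -
    define r where "r x = (INF s\<in>{0..}. q (x + s *\<^sub>R y) - s * q y)" for x
    have bdd: "bdd_below ((\<lambda>s. q (x + s *\<^sub>R y) - s * q y) ` {0..})" for x
    proof (rule bdd_belowI2)
      fix s :: real assume "s \<in> {0..}"
      then show "- q (- x) \<le> q (x + s *\<^sub>R y) - s * q y"
        using sublinear_add[OF q, of "x + s *\<^sub>R y" "- x"] sublinear_scale[OF q, of s y] by simp
    qed
    have lower: "r x \<le> q (x + s *\<^sub>R y) - s * q y" if "0 \<le> s" for s x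
      unfolding r_def using bdd that by (intro cINF_lower) auto
    have "sublinear r"
    proof (rule sublinearI)
      fix x x'
      have *: "r (x + x') \<le> (q (x + s *\<^sub>R y) - s * q y) + (q (x' + t *\<^sub>R y) - t * q y)"
        if "0 \<le> s" "0 \<le> t" for s t
        using lower[of "s + t" "x + x'"] that
          sublinear_add[OF q, of "x + s *\<^sub>R y" "x' + t *\<^sub>R y"]
        by (simp add: algebra_simps)
      have "r (x + x') - (q (x' + t *\<^sub>R y) - t * q y) \<le> r x" if "0 \<le> t" for t
        unfolding r_def[of x] using * that by (intro cINF_greatest) (auto simp: diff_le_eq)
      then have "r (x + x') - r x \<le> r x'"
        unfolding r_def[of x'] by (intro cINF_greatest) (auto simp: algebra_simps)
      then show "r (x + x') \<le> r x + r x'"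
        by simp
    next
      fix c :: real and x assume "0 < c"
      have "r (c *\<^sub>R x) / c \<le> r x"
        unfolding r_def[of x]
      proof (rule cINF_greatest)
        fix s :: real assume "s \<in> {0..}"
        then show "r (c *\<^sub>R x) / c \<le> q (x + s *\<^sub>R y) - s * q y"
          using lower[of "c * s" "c *\<^sub>R x"] sublinear_scale[OF q, of c "x + s *\<^sub>R y"] \<open>0 < c\<close>
          by (simp add: field_simps)
      qed simp
      then show "r (c *\<^sub>R x) \<le> c * r x"
        using \<open>0 < c\<close> by (simp add: field_simps)
    qed
    moreover have "r \<le> q"
      using lower[of 0] by (simp add: le_fun_def)
    ultimately have "r = q"
      by (rule min)
    then show ?thesis
      using lower[of 1 "- y"] sublinear_zero[OF q] by simp
  qed
  have minus: "q (- y) = - q y" for y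
    using le[of y] sublinear_ge_minus[OF q, of y] by simp
  show ?thesis
  proof (rule linearI)
    fix x y
    show "q (x + y) = q x + q y"
      using sublinear_add[OF q, of x y] sublinear_add[OF q, of "x + y" "- y"] minus[of y] by simp
  next
    fix c x
    show "q (c *\<^sub>R x) = c *\<^sub>R q x"
      using sublinear_scale[OF q, of c x] sublinear_scale[OF q, of "- c" x] minus[of "c *\<^sub>R x"]
      by (cases "0 \<le> c") auto
  qed
qed

theorem linear_below_sublinear:
  assumes p: "sublinear p"
  obtains f where "linear f" and "\<And>x. f x \<le> p x"
proof -
  define A where "A = {q. sublinear q \<and> q \<le> p}"
  define above where "above = (\<lambda>q r :: 'a \<Rightarrow> real. r \<le> q)"
  have "\<exists>m\<in>A. \<forall>q\<in>A. above m q \<longrightarrow> q = m"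
  proof (rule predicate_Zorn)
    show "partial_order_on A (relation_of above A)"
      by (rule partial_order_on_relation_ofI) (auto simp: above_def)
  next
    fix C assume "C \<in> Chains (relation_of above A)"
    then have C: "C \<subseteq> A" "\<And>q r. q \<in> C \<Longrightarrow> r \<in> C \<Longrightarrow> q \<le> r \<or> r \<le> q"
      by (auto simp: Chains_def relation_of_def above_def)
    show "\<exists>u\<in>A. \<forall>q\<in>C. above q u"
    proof (cases "C = {}")
      case True
      then show ?thesis using p by (auto simp: A_def)
    next
      case False
      have sub: "\<And>q. q \<in> C \<Longrightarrow> sublinear q" and le: "\<And>q. q \<in> C \<Longrightarrow> q \<le> p"
        using C(1) by (auto simp: A_def)
      note inf = sublinear_INF_chain[OF False sub le C(2)]
      obtain q where "q \<in> C" using False by auto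
      then have "(\<lambda>x. INF q\<in>C. q x) \<le> p"
        using inf(2) le order_trans by blast
      then show ?thesis
        using inf by (auto simp: A_def above_def intro!: bexI[of _ "\<lambda>x. INF q\<in>C. q x"])
    qed
  qed
  then obtain m where m: "m \<in> A" "\<And>q. q \<in> A \<Longrightarrow> q \<le> m \<Longrightarrow> q = m"
    by (auto simp: above_def)
  have "linear m"
    using m by (intro minimal_sublinear_linear) (auto simp: A_def intro: order_trans)
  with m(1) show thesis
    by (intro that) (auto simp: A_def le_fun_def)
qed

section \<open>Separation of a point from a convex set with interior\<close>

text \<open>Order the space by the convex cone \<open>C\<close> of positive multiples of \<open>K\<close> and let \<open>p u\<close> be the infimum of
all \<open>s\<close> with \<open>s k - u \<in> C\<close>. The interior point \<open>k\<close> acts as an order unit, which makes \<open>p\<close> finite and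
bounded by a multiple of the norm; \<open>0 \<notin> K\<close> keeps it from being \<open>-\<infinity>\<close>. A linear \<open>f \<le> p\<close> is then
bounded, nonnegative on \<open>K\<close> because \<open>p (- z) \<le> 0\<close> there, and positive at \<open>k\<close>; \<open>- f\<close> is normalized.\<close>

theorem separate_zero_from_convex_with_interior:
  fixes K :: "'a::real_normed_vector set"
  assumes "convex K" and "0 < r" and ball: "ball k r \<subseteq> K" and "0 \<notin> K"
  obtains f :: "'a dual" where "norm f = 1" and "\<forall>z\<in>K. blinfun_apply f z \<le> 0"
proof -
  define S where "S u = {s. \<exists>l>0. \<exists>z\<in>K. s *\<^sub>R k - u = l *\<^sub>R z}" for u
  define p where "p u = Inf (S u)" for u
  have S_add: "s + t \<in> S (u + v)" if "s \<in> S u" "t \<in> S v" for s t u v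
  proof -
    from that obtain l z m w where lz: "0 < l" "z \<in> K" "s *\<^sub>R k - u = l *\<^sub>R z"
      "0 < m" "w \<in> K" "t *\<^sub>R k - v = m *\<^sub>R w"
      by (auto simp: S_def)
    have "(l / (l + m)) *\<^sub>R z + (m / (l + m)) *\<^sub>R w \<in> K"
      using \<open>convex K\<close> lz by (intro convexD) (auto simp: add_divide_distrib[symmetric])
    moreover have "(s + t) *\<^sub>R k - (u + v) =
        (l + m) *\<^sub>R ((l / (l + m)) *\<^sub>R z + (m / (l + m)) *\<^sub>R w)"
    proof -
      have "(s + t) *\<^sub>R k - (u + v) = l *\<^sub>R z + m *\<^sub>R w"
        using lz(3,6) by (simp add: algebra_simps)
      then show ?thesis
        using lz(1,4) by (simp add: scaleR_add_right)
    qed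
    moreover have "0 < l + m" using lz by simp
    ultimately show ?thesis
      unfolding S_def by blast
  qed
  have S_scale: "c * s \<in> S (c *\<^sub>R u)" if "s \<in> S u" "0 < c" for c s u
  proof -
    from that obtain l z where "0 < l" "z \<in> K" "s *\<^sub>R k - u = l *\<^sub>R z"
      by (auto simp: S_def)
    then show ?thesis
      using that(2)
      by (auto simp: S_def scaleR_diff_right[symmetric] scaleR_scaleR[symmetric]
          simp del: scaleR_scaleR intro!: exI[of _ "c * l"] bexI[of _ z])
  qed
  \<comment> \<open>The factor \<open>2\<close> puts \<open>u / s\<close> strictly inside the ball of radius \<open>r\<close>.\<close>
  have S_bound: "2 * norm u / r \<in> S u" if "u \<noteq> 0" for u
  proof -
    let ?s = "2 * norm u / r"
    have s: "0 < ?s" using that \<open>0 < r\<close> by simp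
    have "norm ((1 / ?s) *\<^sub>R u) < r"
      using that \<open>0 < r\<close> by simp
    then have "k - (1 / ?s) *\<^sub>R u \<in> K"
      using ball by (auto simp: dist_norm)
    moreover have "?s *\<^sub>R k - u = ?s *\<^sub>R (k - (1 / ?s) *\<^sub>R u)"
      using s that \<open>0 < r\<close> by (simp add: scaleR_diff_right)
    ultimately show ?thesis
      unfolding S_def using s by blast
  qed
  have "k \<in> K" using ball \<open>0 < r\<close> by auto
  \<comment> \<open>Otherwise \<open>0\<close> is a convex combination of \<open>k\<close> and the point \<open>z\<close> with \<open>s k = l z\<close>.\<close>
  have S_zero: "0 < s" if "s \<in> S 0" for s
  proof (rule ccontr)
    assume "\<not> 0 < s"
    from that obtain l z where lz: "0 < l" "z \<in> K" "s *\<^sub>R k = l *\<^sub>R z"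
      by (auto simp: S_def)
    have "(l / (l - s)) *\<^sub>R z + (- s / (l - s)) *\<^sub>R k \<in> K"
      using \<open>convex K\<close> lz \<open>k \<in> K\<close> \<open>\<not> 0 < s\<close>
      by (intro convexD) (auto simp: diff_divide_distrib[symmetric] divide_nonpos_pos)
    also have "(l / (l - s)) *\<^sub>R z + (- s / (l - s)) *\<^sub>R k = (1 / (l - s)) *\<^sub>R (l *\<^sub>R z - s *\<^sub>R k)"
      by (simp add: scaleR_diff_right)
    also have "\<dots> = 0" using lz by simp
    finally show False using \<open>0 \<notin> K\<close> by simp
  qed
  have S_nonempty: "S u \<noteq> {}" for u
  proof (cases "u = 0")
    case True
    have "1 \<in> S 0"
      using \<open>k \<in> K\<close> by (auto simp: S_def intro!: exI[of _ 1] bexI[of _ k])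
    then show ?thesis using True by auto
  qed (use S_bound in auto)
  have bdd: "bdd_below (S u)" for u
  proof -
    obtain t where "t \<in> S (- u)" using S_nonempty by blast
    then have "- t \<le> s" if "s \<in> S u" for s
      using S_zero[of "s + t"] S_add[OF that, of t "- u"] by simp
    then show ?thesis by (rule bdd_belowI)
  qed
  have lower: "p u \<le> s" if "s \<in> S u" for s u
    unfolding p_def using that bdd by (rule cInf_lower)
  have "sublinear p"
  proof (rule sublinearI)
    fix u v
    have "p (u + v) - t \<le> p u" if "t \<in> S v" for t
      unfolding p_def[of u] using lower[OF S_add[OF _ that]] S_nonempty
      by (intro cInf_greatest) (auto simp: diff_le_eq)
    then have "p (u + v) - p u \<le> p v"
      unfolding p_def[of v] using S_nonempty by (intro cInf_greatest) (auto simp: algebra_simps)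
    then show "p (u + v) \<le> p u + p v" by simp
  next
    fix c :: real and u assume "0 < c"
    have "p (c *\<^sub>R u) / c \<le> p u"
      unfolding p_def[of u] using lower[OF S_scale[OF _ \<open>0 < c\<close>]] S_nonempty \<open>0 < c\<close>
      by (intro cInf_greatest) (auto simp: field_simps)
    then show "p (c *\<^sub>R u) \<le> c * p u"
      using \<open>0 < c\<close> by (simp add: field_simps)
  qed
  then obtain f where f: "linear f" "\<And>u. f u \<le> p u"
    using linear_below_sublinear by blast
  have f_le: "f u \<le> s" if "s \<in> S u" for s u
    using f(2)[of u] lower[OF that] by simp
  have le: "f u \<le> norm u * (2 / r)" for u
    using f_le[OF S_bound, of u] linear_0[OF f(1)] by (cases "u = 0") (auto simp: mult.commute)
  have norm_le: "norm (f u) \<le> norm u * (2 / r)" for u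
    using le[of u] le[of "- u"] linear_neg[OF f(1), of u] by (auto simp: abs_if)
  then have bl: "bounded_linear f"
    using f(1) by (intro bounded_linear_intro[OF _ _ norm_le]) (auto simp: linear_add linear_scale)
  have K: "0 \<le> f z" if "z \<in> K" for z
  proof -
    have "0 \<in> S (- z)"
      using that by (auto simp: S_def intro!: exI[of _ 1] bexI[of _ z])
    then show ?thesis using f_le linear_neg[OF f(1), of z] by fastforce
  qed
  have "k \<noteq> 0" using \<open>k \<in> K\<close> \<open>0 \<notin> K\<close> by auto
  \<comment> \<open>Any \<open>s\<close> with \<open>-1 < s < 0\<close> serves here, since \<open>s k + k\<close> is a positive multiple of \<open>k\<close>.\<close>
  have "- (1 / 2) \<in> S (- k)"
  proof -
    have "- (1 / 2) *\<^sub>R k - - k = (1 / 2) *\<^sub>R k"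
      using scaleR_half_double[of k] by (simp add: algebra_simps scaleR_left.minus
       flip: scaleR_add_left)
    then show ?thesis
      using \<open>k \<in> K\<close> unfolding S_def by (auto intro!: exI[of _ "1 / 2"] bexI[of _ k])
  qed
  then have "f k \<noteq> 0"
    using f_le linear_neg[OF f(1), of k] by fastforce
  define g where "g = Blinfun f"
  have g: "blinfun_apply g = f"
    by (simp add: g_def bounded_linear_Blinfun_apply bl)
  with \<open>f k \<noteq> 0\<close> have "g \<noteq> 0" by auto
  show thesis
  proof (rule that)
    show "norm (- (1 / norm g) *\<^sub>R g) = 1"
      using \<open>g \<noteq> 0\<close> by simp
    show "\<forall>z\<in>K. blinfun_apply (- (1 / norm g) *\<^sub>R g) z \<le> 0"
      using K by (simp add: g blinfun.minus_left blinfun.scaleR_left)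
  qed
qed

section \<open>Weak* compactness of the dual unit ball\<close>

lemma compactin_pullback_topology:
  assumes "S \<subseteq> A" and "compactin T (f ` S)"
  shows "compactin (pullback_topology A f T) S"
  unfolding compactin_def
proof (intro conjI allI impI)
  show "S \<subseteq> topspace (pullback_topology A f T)"
    using assms compactin_subset_topspace by (fastforce simp: topspace_pullback_topology)
next
  fix \<U> assume \<U>: "Ball \<U> (openin (pullback_topology A f T)) \<and> S \<subseteq> \<Union>\<U>"
  then have "\<forall>U\<in>\<U>. \<exists>V. openin T V \<and> U = f -` V \<inter> A"
    by (auto simp: openin_pullback_topology)
  then obtain V where V: "\<And>U. U \<in> \<U> \<Longrightarrow> openin T (V U) \<and> U = f -` V U \<inter> A"
    by metis
  have "f ` S \<subseteq> \<Union>(V ` \<U>)"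
    using \<U> V by blast
  then obtain \<F> where "finite \<F>" "\<F> \<subseteq> V ` \<U>" "f ` S \<subseteq> \<Union>\<F>"
    using assms(2) V unfolding compactin_def by (metis imageE)
  then obtain \<G> where \<G>: "finite \<G>" "\<G> \<subseteq> \<U>" "f ` S \<subseteq> \<Union>(V ` \<G>)"
    using finite_subset_image[of \<F> V \<U>] by auto
  then have "S \<subseteq> \<Union>\<G>"
    using V assms(1) by blast
  with \<G> show "\<exists>\<F>. finite \<F> \<and> \<F> \<subseteq> \<U> \<and> S \<subseteq> \<Union>\<F>"
    by blast
qed

text \<open>As functions on the space, the functionals of norm at most \<open>1\<close> are exactly the linear maps in the
product of the intervals \<open>[- norm x, norm x]\<close>. The product is compact by Tychonoff's theorem, and
linearity is a closed condition for pointwise convergence.\<close>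

theorem Banach_Alaoglu:
  "compactin weak_star {f :: ('a::real_normed_vector) dual. norm f \<le> 1}"
proof -
  let ?B = "{f :: 'a dual. norm f \<le> 1}"
  let ?K = "PiE UNIV (\<lambda>x::'a. cball (0::real) (norm x))"
  let ?L = "{\<phi> :: 'a \<Rightarrow> real. linear \<phi>}"
  have ev: "continuous_on UNIV (\<lambda>\<phi> :: 'a \<Rightarrow> real. \<phi> x)" for x
    by (rule continuous_on_product_coordinates)
  have "compactin (product_topology (\<lambda>_. euclidean) UNIV) ?K"
    by (simp add: compactin_PiE)
  then have "compact ?K"
    by (simp add: euclidean_product_topology)
  moreover have "closed ?L"
    unfolding linear_iff
    by (intro closed_Collect_conj closed_Collect_all closed_Collect_eq continuous_intros ev)
  ultimately have "compact (?K \<inter> ?L)"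
    by (rule compact_Int_closed)
  moreover have "blinfun_apply ` ?B = ?K \<inter> ?L"
  proof (intro equalityI subsetI)
    fix \<phi> assume "\<phi> \<in> blinfun_apply ` ?B"
    then obtain f where f: "\<phi> = blinfun_apply f" "norm f \<le> 1" by auto
    have "norm (blinfun_apply f x) \<le> norm x" for x
      using norm_blinfun[of f x] f(2) mult_right_mono[of "norm f" 1 "norm x"] by simp
    then show "\<phi> \<in> ?K \<inter> ?L"
      by (simp add: f(1) linear_iff blinfun.add_right blinfun.scaleR_right PiE_UNIV_domain)
  next
    fix \<phi> assume \<phi>: "\<phi> \<in> ?K \<inter> ?L"
    then have le: "norm (\<phi> x) \<le> norm x * 1" for x
      by (simp add: PiE_UNIV_domain Pi_iff)
    then have bl: "bounded_linear \<phi>"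
      using \<phi> by (intro bounded_linear_intro[OF _ _ le]) (auto simp: linear_iff)
    have "norm (Blinfun \<phi>) \<le> 1"
      using le by (intro norm_blinfun_bound) (auto simp: bounded_linear_Blinfun_apply bl)
    then show "\<phi> \<in> blinfun_apply ` ?B"
      by (intro image_eqI[of _ _ "Blinfun \<phi>"]) (simp_all add: bounded_linear_Blinfun_apply bl)
  qed
  ultimately show ?thesis
    unfolding strong_operator_topology_def by (intro compactin_pullback_topology) auto
qed

lemma closedin_weak_star_halfspace:
  "closedin weak_star {f :: ('a::real_normed_vector) dual. blinfun_apply f v \<le> c}"
  using closedin_continuous_map_preimage[OF strong_operator_topology_continuous_evaluation[of v],
      of "{..c}"]
  by (simp add: strong_operator_topology_topspace)

section \<open>Upper semi-continuous regularization of bounded maps into the dual\<close>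

text \<open>By Hahn-Banach this is the weak* closed convex hull. The description by half-spaces is the one that
matters later: a bound on all \<open>g v\<close> with \<open>g \<in> A\<close> passes to the hull.\<close>

definition weak_star_hull :: "('a::real_normed_vector) dual set \<Rightarrow> 'a dual set"
  where "weak_star_hull A = {f. \<forall>v c. (\<forall>g\<in>A. blinfun_apply g v \<le> c) \<longrightarrow> blinfun_apply f v \<le> c}"

lemma weak_star_hull_eq_Inter:
  "weak_star_hull A = \<Inter>((\<lambda>(v, c). {f. blinfun_apply f v \<le> c}) ` {(v, c). \<forall>g\<in>A. blinfun_apply g v \<le> c})"
  by (auto simp: weak_star_hull_def)

lemma weak_star_hull_le:
  "f \<in> weak_star_hull A \<Longrightarrow> (\<And>g. g \<in> A \<Longrightarrow> blinfun_apply g v \<le> c) \<Longrightarrow> blinfun_apply f v \<le> c"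
  by (auto simp: weak_star_hull_def)

lemma weak_star_hull_superset: "A \<subseteq> weak_star_hull A"
  by (auto simp: weak_star_hull_def)

lemma weak_star_hull_mono: "A \<subseteq> B \<Longrightarrow> weak_star_hull A \<subseteq> weak_star_hull B"
  unfolding weak_star_hull_def by blast

lemma convex_weak_star_hull: "convex (weak_star_hull A)"
  unfolding weak_star_hull_eq_Inter
  by (intro convex_INT)
    (auto simp: convex_def blinfun.add_left blinfun.scaleR_left intro: convex_bound_le)

lemma closedin_weak_star_hull: "closedin weak_star (weak_star_hull A)"
proof -
  have "(0, 0) \<in> {(v, c). \<forall>g\<in>A. blinfun_apply g v \<le> c}"
    by simp
  then have "{(v, c). \<forall>g\<in>A. blinfun_apply g v \<le> c} \<noteq> {}"
    by blast
  then show ?thesis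
    unfolding weak_star_hull_eq_Inter
    by (intro closedin_INT) (auto intro: closedin_weak_star_halfspace)
qed

lemma weak_star_hull_in_unit_ball:
  assumes "\<And>g. g \<in> A \<Longrightarrow> norm g \<le> 1" and "f \<in> weak_star_hull A"
  shows "norm f \<le> 1"
proof (rule norm_blinfun_bound)
  have le: "blinfun_apply f v \<le> norm v" for v
  proof (rule weak_star_hull_le[OF assms(2)])
    fix g assume "g \<in> A"
    then show "blinfun_apply g v \<le> norm v"
      using norm_blinfun[of g v] assms(1)[of g] mult_right_mono[of "norm g" 1 "norm v"] by simp
  qed
  show "norm (blinfun_apply f v) \<le> 1 * norm v" for v
    using le[of v] le[of "- v"] by (simp add: blinfun.minus_right abs_le_iff)
qed simp

text \<open>A convexified outer limit of \<open>A\<close> at \<open>p\<close>: a functional \<open>f\<close> belongs to it if and only if, for every \<open>v\<close>,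
\<open>f v\<close> is at most the upper limit, as \<open>q\<close> tends to \<open>p\<close> (with \<open>q = p\<close> admitted), of the supremum of
\<open>g v\<close> over \<open>g \<in> A q\<close>.\<close>

definition weak_star_regularization ::
    "('p::metric_space \<Rightarrow> ('a::real_normed_vector) dual set) \<Rightarrow> 'p \<Rightarrow> 'a dual set"
  where "weak_star_regularization A p = (\<Inter>e\<in>{0<..}. weak_star_hull (\<Union>q\<in>ball p e. A q))"

lemma weak_star_regularization_subset_hull:
  "0 < e \<Longrightarrow> weak_star_regularization A p \<subseteq> weak_star_hull (\<Union>q\<in>ball p e. A q)"
  by (auto simp: weak_star_regularization_def)

lemma weak_star_regularization_superset: "A p \<subseteq> weak_star_regularization A p"
proof -
  have "A p \<subseteq> weak_star_hull (\<Union>q\<in>ball p e. A q)" if "0 < e" for e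
    using weak_star_hull_superset[of "\<Union>q\<in>ball p e. A q"] that by force
  then show ?thesis
    by (auto simp: weak_star_regularization_def)
qed

lemma convex_weak_star_regularization: "convex (weak_star_regularization A p)"
  unfolding weak_star_regularization_def by (intro convex_INT convex_weak_star_hull)

lemma compactin_weak_star_hull:
  assumes "\<And>g. g \<in> A \<Longrightarrow> norm g \<le> 1"
  shows "compactin weak_star (weak_star_hull A)"
  using weak_star_hull_in_unit_ball[OF assms]
  by (intro closed_compactin[OF Banach_Alaoglu _ closedin_weak_star_hull]) auto

lemma compactin_weak_star_regularization:
  assumes "\<And>q g. g \<in> A q \<Longrightarrow> norm g \<le> 1"
  shows "compactin weak_star (weak_star_regularization A p)"
proof (rule closed_compactin[OF compactin_weak_star_hull])
  show "weak_star_regularization A p \<subseteq> weak_star_hull (\<Union>q\<in>ball p 1. A q)"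
    by (rule weak_star_regularization_subset_hull) simp
  show "closedin weak_star (weak_star_regularization A p)"
    unfolding weak_star_regularization_def by (intro closedin_INT closedin_weak_star_hull) auto
qed (use assms in auto)

text \<open>If an open \<open>V\<close> contains the intersection of the decreasing compact sets \<open>H e\<close>, it already contains
some \<open>H d\<close>; and \<open>H d\<close> contains the values at all points of \<open>ball p d\<close>, because each such point has a
ball around it inside \<open>ball p d\<close>.\<close>

lemma upper_semicontinuous_weak_star_regularization:
  assumes "\<And>q g. g \<in> A q \<Longrightarrow> norm g \<le> 1"
  shows "upper_semicontinuous_setmap euclidean weak_star (weak_star_regularization A)"
  unfolding upper_semicontinuous_setmap_def
proof (intro ballI allI impI)
  fix p V assume V: "openin weak_star V \<and> weak_star_regularization A p \<subseteq> V"
  define H where "H e = weak_star_hull (\<Union>q\<in>ball p e. A q)" for e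
  have H_mono: "H d \<subseteq> H e" if "d \<le> e" for d e
    unfolding H_def using subset_ball[OF that, of p] by (intro weak_star_hull_mono) blast
  have "compactin weak_star (H 1 - V)"
  proof (rule closed_compactin)
    show "compactin weak_star (H 1)"
      unfolding H_def using assms by (intro compactin_weak_star_hull) auto
    show "closedin weak_star (H 1 - V)"
      using V by (intro closedin_diff) (auto simp: H_def closedin_weak_star_hull)
  qed auto
  moreover have "\<forall>U\<in>(\<lambda>e. - H e) ` {0<..}. openin weak_star U"
    using closedin_weak_star_hull
    by (auto simp: H_def closedin_def strong_operator_topology_topspace Compl_eq_Diff_UNIV)
  moreover have "H 1 - V \<subseteq> \<Union>((\<lambda>e. - H e) ` {0<..})"
    using V by (auto simp: weak_star_regularization_def H_def)
  ultimately obtain \<F> where "finite \<F>" "\<F> \<subseteq> (\<lambda>e. - H e) ` {0<..}" "H 1 - V \<subseteq> \<Union>\<F>"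
    unfolding compactin_def by meson
  then obtain E where E: "finite E" "E \<subseteq> {0<..}" "H 1 - V \<subseteq> (\<Union>e\<in>E. - H e)"
    using finite_subset_image[of \<F> "\<lambda>e. - H e" "{0<..}"] by auto
  \<comment> \<open>The element \<open>1\<close> keeps \<open>H d\<close> inside the compact set \<open>H 1\<close> and covers the case of empty \<open>E\<close>.\<close>
  define d where "d = Min (insert 1 E)"
  have "0 < d" and d_le: "d \<le> 1" "\<And>e. e \<in> E \<Longrightarrow> d \<le> e"
    using E by (auto simp: d_def)
  have "H d \<subseteq> V"
    using E(3) H_mono[OF d_le(1)] H_mono[OF d_le(2)] by blast
  have "weak_star_regularization A u \<subseteq> V" if "u \<in> ball p d" for u
  proof -
    have "weak_star_regularization A u \<subseteq> weak_star_hull (\<Union>q\<in>ball u (d - dist p u). A q)"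
      using that by (intro weak_star_regularization_subset_hull) simp
    also have "\<dots> \<subseteq> H d"
      unfolding H_def
    proof (intro weak_star_hull_mono UN_mono subsetI)
      fix q assume "q \<in> ball u (d - dist p u)"
      then show "q \<in> ball p d"
        using dist_triangle[of p q u] by simp
    qed simp
    finally show ?thesis using \<open>H d \<subseteq> V\<close> by simp
  qed
  then show "\<exists>U. openin euclidean U \<and> p \<in> U \<and> (\<forall>u\<in>U. weak_star_regularization A u \<subseteq> V)"
    using \<open>0 < d\<close> by (intro exI[of _ "ball p d"]) auto
qed

section \<open>Normal cones of mid-point continuous maps\<close>

text \<open>The three neighbourhoods in the definition of mid-point continuity, replaced by balls of one common
radius.\<close>

lemma midpoint_continuous_uniform_ball:
  fixes P :: "'a::real_normed_vector \<times> 'b::real_normed_vector \<Rightarrow> 'a set"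
  assumes "midpoint_continuous P" and "z \<in> P (x, y)"
  obtains t e where "0 \<le> t" "t < 1" "0 < e"
    "\<forall>q\<in>ball (x, y) e. ball (t *\<^sub>R x + (1 - t) *\<^sub>R z) e \<subseteq> P q"
proof -
  have "\<exists>t V W Q. 0 \<le> t \<and> t < (1::real) \<and> open V \<and> open W \<and> open Q \<and>
      t *\<^sub>R x + (1 - t) *\<^sub>R z \<in> V \<and> x \<in> W \<and> y \<in> Q \<and>
      (\<forall>w'\<in>V. \<forall>x'\<in>W. \<forall>y'\<in>Q. w' \<in> P (x', y'))"
    using assms unfolding midpoint_continuous_def by simp
  then obtain t V W Q where t: "0 \<le> t" "t < 1"
    and op: "open V" "open W" "open Q" "t *\<^sub>R x + (1 - t) *\<^sub>R z \<in> V" "x \<in> W" "y \<in> Q"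
    and P: "\<forall>w'\<in>V. \<forall>x'\<in>W. \<forall>y'\<in>Q. w' \<in> P (x', y')"
    by (elim exE conjE)
  let ?v = "t *\<^sub>R x + (1 - t) *\<^sub>R z"
  obtain a b c where abc: "0 < a" "ball ?v a \<subseteq> V" "0 < b" "ball x b \<subseteq> W" "0 < c" "ball y c \<subseteq> Q"
    using openE[OF op(1,4)] openE[OF op(2,5)] openE[OF op(3,6)] by metis
  define e where "e = min a (min b c)"
  have "ball ?v e \<subseteq> P q" if "q \<in> ball (x, y) e" for q
  proof
    fix w assume "w \<in> ball ?v e"
    then have "w \<in> V" using abc(2) by (auto simp: e_def)
    moreover have "fst q \<in> ball x b" "snd q \<in> ball y c"
      using that dist_fst_le[of "(x, y)" q] dist_snd_le[of "(x, y)" q] by (simp_all add: e_def)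
    ultimately have "w \<in> P (fst q, snd q)"
      using P abc(4,6) by blast
    then show "w \<in> P q"
      by simp
  qed
  moreover have "0 < e" using abc by (simp add: e_def)
  ultimately show thesis using t that[of t e] by simp
qed

lemma norm_dual_le:
  fixes g :: "('a::real_normed_vector) dual"
  assumes le: "\<And>b. norm b \<le> 1 \<Longrightarrow> blinfun_apply g b \<le> C"
  shows "norm g \<le> C"
proof (rule norm_blinfun_bound)
  show "0 \<le> C" using le[of 0] by simp
  fix u
  have "blinfun_apply g u / norm u \<le> C" if "u \<noteq> 0" for u
    using le[of "(1 / norm u) *\<^sub>R u"] that by (simp add: blinfun.scaleR_right)
  from this[of u] this[of "- u"] show "norm (blinfun_apply g u) \<le> C * norm u"
    by (cases "u = 0") (auto simp: blinfun.minus_right field_simps abs_le_iff)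
qed

lemma normal_cone_iff:
  "P (x, y) \<noteq> {} \<Longrightarrow>
    f \<in> normal_cone P (x, y) \<longleftrightarrow> (\<forall>z\<in>P (x, y). blinfun_apply f (z - x) \<le> 0)"
  by (simp add: normal_cone_def)

text \<open>Since \<open>v - x\<close> and \<open>v - x'\<close> differ by less than \<open>r\<close>, the ball of radius \<open>r\<close> around \<open>v - x\<close> consists of
directions pointing from \<open>x'\<close> into \<open>P (x', y')\<close>, on which \<open>g\<close> is at most \<open>0\<close>. The supremum of \<open>g\<close> over
this ball is \<open>g (v - x) + r * norm g\<close>. The reference point \<open>x\<close> does not move with \<open>x'\<close>, so the
conclusion bounds all these \<open>g\<close> at one common vector.\<close>

lemma normal_cone_uniformly_negative:
  assumes "norm (x' - x) < r" and "ball v (2 * r) \<subseteq> P (x', y')" and "0 < r"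
    and "g \<in> normal_cone P (x', y')"
  shows "blinfun_apply g (v - x) \<le> - r * norm g"
proof -
  have "v \<in> P (x', y')" using assms(2,3) by auto
  have "norm g \<le> - blinfun_apply g (v - x) / r"
  proof (rule norm_dual_le)
    fix b :: 'a assume "norm b \<le> 1"
    then have "norm ((x' - x) + r *\<^sub>R b) < r + r"
      using assms(1,3)
      by (intro order.strict_trans1[OF norm_triangle_ineq] add_less_le_mono) (auto simp: mult_left_le)
    then have "v + ((x' - x) + r *\<^sub>R b) \<in> ball v (2 * r)"
      unfolding mem_ball dist_norm by (subst norm_minus_commute) simp
    then have "blinfun_apply g (v + ((x' - x) + r *\<^sub>R b) - x') \<le> 0"
      using assms(2,4) \<open>v \<in> P (x', y')\<close> normal_cone_iff[of P x' y'] by blast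
    also have "v + ((x' - x) + r *\<^sub>R b) - x' = (v - x) + r *\<^sub>R b"
      by simp
    finally show "blinfun_apply g b \<le> - blinfun_apply g (v - x) / r"
      using \<open>0 < r\<close> unfolding blinfun.add_right blinfun.scaleR_right by (simp add: field_simps)
  qed
  then show ?thesis using \<open>0 < r\<close> by (simp add: field_simps)
qed

lemma normal_cone_unit_functional:
  assumes "convex (P (x, y))" and "x \<notin> P (x, y)" and "ball v e \<subseteq> P (x, y)" and "0 < e"
  shows "\<exists>f\<in>normal_cone P (x, y). norm f = 1"
proof -
  let ?K = "(\<lambda>z. z - x) ` P (x, y)"
  have "ball (v - x) e \<subseteq> ?K"
  proof
    fix b assume "b \<in> ball (v - x) e"
    then have "b + x \<in> P (x, y)"
      using assms(3) by (auto simp: dist_norm algebra_simps)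
    then show "b \<in> ?K" by force
  qed
  moreover have "convex ?K" using assms(1) by (rule convex_translation_subtract)
  moreover have "0 \<notin> ?K" using assms(2) by auto
  ultimately obtain f :: "'a dual" where "norm f = 1" "\<forall>b\<in>?K. blinfun_apply f b \<le> 0"
    using separate_zero_from_convex_with_interior[of ?K e "v - x"] \<open>0 < e\<close> by blast
  then show ?thesis
    by (auto simp: normal_cone_def)
qed

section \<open>The upper semi-continuous normal map\<close>

theorem proposition4p4:
  fixes P :: "'a::banach \<times> 'b::banach \<Rightarrow> 'a set"
  assumes "\<And>x y. convex (P (x, y))"
    and "midpoint_continuous P"
    and "\<And>x y. x \<notin> P (x, y)"
  shows "\<exists>F :: 'a \<times> 'b \<Rightarrow> 'a dual set.
    upper_semicontinuous_setmap euclidean weak_star F \<and>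
    (\<forall>x y. F (x, y) \<noteq> {} \<and> convex (F (x, y)) \<and> compactin weak_star (F (x, y))) \<and>
    (\<forall>x y. P (x, y) \<noteq> {} \<longrightarrow> F (x, y) \<subseteq> normal_cone P (x, y) - {0})"
proof -
  \<comment> \<open>Where \<open>P p\<close> is empty, any non-empty subset of the unit ball would do; \<open>{0}\<close> is one even in the
    trivial space, which has no unit functionals.\<close>
  define A where "A p = (if P p = {} then {0} else {f \<in> normal_cone P p. norm f = 1})" for p
  define F where "F = weak_star_regularization A"
  have A_norm: "norm g \<le> 1" if "g \<in> A q" for q g
    using that by (auto simp: A_def split: if_splits)
  have A_nonempty: "A (x, y) \<noteq> {}" for x y
  proof (cases "P (x, y) = {}")
    case False
    then obtain z where "z \<in> P (x, y)" by auto
    with assms(2) obtain t e where "0 \<le> t" "t < 1" "0 < e"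
      "\<forall>q\<in>ball (x, y) e. ball (t *\<^sub>R x + (1 - t) *\<^sub>R z) e \<subseteq> P q"
      by (rule midpoint_continuous_uniform_ball)
    then have "ball (t *\<^sub>R x + (1 - t) *\<^sub>R z) e \<subseteq> P (x, y)" using \<open>0 < e\<close> by simp
    from normal_cone_unit_functional[of P x y, OF assms(1,3) this \<open>0 < e\<close>] False
    show ?thesis by (auto simp: A_def)
  qed (simp add: A_def)
  have F_le: "blinfun_apply f u \<le> c"
    if "f \<in> F p" "0 < e" "\<And>q g. q \<in> ball p e \<Longrightarrow> g \<in> A q \<Longrightarrow> blinfun_apply g u \<le> c" for f p e u c
    using weak_star_regularization_subset_hull[OF that(2), of A p] that(1,3)
    by (intro weak_star_hull_le[of f "\<Union>q\<in>ball p e. A q"]) (auto simp: F_def)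
  have normal: "f \<in> normal_cone P (x, y)" if f: "f \<in> F (x, y)" and ne: "P (x, y) \<noteq> {}" for f x y
    unfolding normal_cone_iff[of P x y, OF ne]
  proof
    fix z assume "z \<in> P (x, y)"
    with assms(2) obtain t e where te: "0 \<le> t" "t < 1" "0 < e"
      "\<forall>q\<in>ball (x, y) e. ball (t *\<^sub>R x + (1 - t) *\<^sub>R z) e \<subseteq> P q"
      by (rule midpoint_continuous_uniform_ball)
    let ?v = "t *\<^sub>R x + (1 - t) *\<^sub>R z"
    \<comment> \<open>At the nearby point \<open>(x', y')\<close> the bound is \<open>0\<close> for the vector from \<open>x'\<close> to \<open>?v\<close>; moving \<open>x'\<close> to \<open>x\<close>
      costs a unit functional at most \<open>d\<close>.\<close>
    have le: "blinfun_apply f (?v - x) \<le> d" if d: "0 < d" "d \<le> e" for d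
    proof (rule F_le[OF f \<open>0 < d\<close>])
      fix q g assume q: "q \<in> ball (x, y) d" and g: "g \<in> A q"
      obtain x' y' where [simp]: "q = (x', y')" by (cases q)
      have "q \<in> ball (x, y) e"
        using q d subset_ball[of d e] by blast
      then have "ball ?v e \<subseteq> P q"
        using te(4) by blast
      then have v: "?v \<in> P (x', y')"
        using te(3) by auto
      with g have g': "norm g = 1" "blinfun_apply g (?v - x') \<le> 0"
        by (auto simp: A_def normal_cone_def split: if_splits)
      have "blinfun_apply g (x' - x) \<le> norm (x' - x)"
        using norm_blinfun[of g "x' - x"] g' by simp
      also have "\<dots> \<le> d"
        using dist_fst_le[of "(x, y)" q] q by (simp add: dist_norm norm_minus_commute)
      finally have "blinfun_apply g ((?v - x') + (x' - x)) \<le> d"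
        using g' unfolding blinfun.add_right by simp
      then show "blinfun_apply g (?v - x) \<le> d" by simp
    qed
    have "blinfun_apply f (?v - x) \<le> 0"
    proof (rule field_le_epsilon)
      fix d :: real assume "0 < d"
      then show "blinfun_apply f (?v - x) \<le> 0 + d"
        using le[of "min d e"] \<open>0 < e\<close> by simp
    qed
    moreover have "?v - x = (1 - t) *\<^sub>R (z - x)"
      by (simp add: algebra_simps)
    ultimately show "blinfun_apply f (z - x) \<le> 0"
      using \<open>t < 1\<close> by (simp add: blinfun.scaleR_right mult_le_0_iff)
  qed
  have nonzero: "f \<noteq> 0" if f: "f \<in> F (x, y)" and ne: "P (x, y) \<noteq> {}" for f x y
  proof -
    from ne obtain z where "z \<in> P (x, y)" by auto
    with assms(2) obtain t e where te: "0 \<le> t" "t < 1" "0 < e"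
      "\<forall>q\<in>ball (x, y) e. ball (t *\<^sub>R x + (1 - t) *\<^sub>R z) e \<subseteq> P q"
      by (rule midpoint_continuous_uniform_ball)
    let ?v = "t *\<^sub>R x + (1 - t) *\<^sub>R z"
    \<comment> \<open>Half of the radius is spent on moving the base point, the other half is the gap.\<close>
    have "blinfun_apply f (?v - x) \<le> - (e / 2)"
    proof (rule F_le[OF f, of "e / 2"])
      fix q g assume q: "q \<in> ball (x, y) (e / 2)" and g: "g \<in> A q"
      obtain x' y' where [simp]: "q = (x', y')" by (cases q)
      have "q \<in> ball (x, y) e"
        using q \<open>0 < e\<close> subset_ball[of "e / 2" e] by auto
      then have v: "ball ?v (2 * (e / 2)) \<subseteq> P (x', y')"
        using te(4) by simp
      then have "P (x', y') \<noteq> {}" using \<open>0 < e\<close> by auto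
      with g have g': "norm g = 1" "g \<in> normal_cone P (x', y')"
        by (auto simp: A_def)
      have "norm (x' - x) < e / 2"
        using dist_fst_le[of "(x, y)" q] q by (simp add: dist_norm norm_minus_commute)
      from normal_cone_uniformly_negative[of _ _ _ _ P, OF this v _ g'(2)] \<open>0 < e\<close> g'(1)
      show "blinfun_apply g (?v - x) \<le> - (e / 2)" by simp
    qed (use \<open>0 < e\<close> in simp)
    then show ?thesis using \<open>0 < e\<close> by auto
  qed
  show ?thesis
  proof (intro exI[of _ F] conjI allI impI)
    show "upper_semicontinuous_setmap euclidean weak_star F"
      unfolding F_def using A_norm by (rule upper_semicontinuous_weak_star_regularization)
    fix x y
    show "F (x, y) \<noteq> {}"
      using A_nonempty[of x y] weak_star_regularization_superset[of A "(x, y)"] by (auto simp: F_def)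
    show "convex (F (x, y))"
      unfolding F_def by (rule convex_weak_star_regularization)
    show "compactin weak_star (F (x, y))"
      unfolding F_def using A_norm by (rule compactin_weak_star_regularization)
    show "F (x, y) \<subseteq> normal_cone P (x, y) - {0}" if "P (x, y) \<noteq> {}"
      using normal nonzero that by blast
  qed
qed

end
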